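(* Let $n\ge0$ be an integer and let $f$ be a continuous function defined on $[a,b]$. For every real $x$ with $x\ne\tilde x_k$ for all $k=1,\dots,n+1$, the anti-Gauss Lagrange interpolant of $f$ can be written in the barycentric form $$\tilde L_{n+1}(f,x)=\frac{\displaystyle\sum_{k=1}^{n+1}\frac{\omega_k}{x-\tilde x_k}f(\tilde x_k)}{\displaystyle\sum_{k=1}^{n+1}\frac{\omega_k}{x-\tilde x_k}},\qquad \omega_k:=\frac{1}{\tilde p_{n+1}'(\tilde x_k)}.$$
   Context: Let $w$ be a weight function on an interval $[a,b]$ (nonnegative, with positive integral and finite moments of all orders), and let $\langle f,g\rangle_w=\int_a^b f(x)g(x)w(x)\,dx$. Let $\{p_n\}_{n\ge0}$ be the sequence of monic orthogonal polynomials with respect to $w$ ($\deg p_n=n$, $\langle p_n,p_m\rangle_w=0$ for $n\ne m$). For $n\ge0$ the anti-Gauss polynomial of degree $n+1$ is $$\tilde p_{n+1}(x)=2p_{n+1}(x)+(a_n-x)p_n(x),\qquad a_n=\frac{\langle xp_n,p_n\rangle_w}{\langle p_n,p_n\rangle_w}.$$ It is known that its zeros $\tilde x_1,\dots,\tilde x_{n+1}$ are real and distinct (so $\tilde p_{n+1}'(\tilde x_k)\neq0$); it is assumed that $w$ is such that they belong to $[a,b]$. The anti-Gauss Lagrange polynomial (interpolant) of $f$ is $$\tilde L_{n+1}(f,x)=\sum_{k=1}^{n+1}\tilde\ell_k(x)f(\tilde x_k),\qquad \tilde\ell_k(x)=\prod_{j=1,\,j\ne k}^{n+1}\frac{x-\tilde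 x_j}{\tilde x_k-\tilde x_j}.$$ *)

theory Defs
  imports "HOL-Analysis.Analysis" "HOL-Computational_Algebra.Polynomial"
begin

text \<open>Integrals over \<open>[a,b]\<close> are Lebesgue integrals.  Positivity of the integral of \<open>w\<close>
  forces \<open>a < b\<close>.\<close>

definition weight_function :: "real \<Rightarrow> real \<Rightarrow> (real \<Rightarrow> real) \<Rightarrow> bool" where
  "weight_function a b w \<longleftrightarrow>
     (\<forall>x\<in>{a..b}. 0 \<le> w x) \<and>
     (\<forall>k::nat. set_integrable lebesgue {a..b} (\<lambda>x. x ^ k * w x)) \<and>
     0 < set_lebesgue_integral lebesgue {a..b} w"

definition weighted_inner ::
    "real \<Rightarrow> real \<Rightarrow> (real \<Rightarrow> real) \<Rightarrow> (real \<Rightarrow> real) \<Rightarrow> (real \<Rightarrow> real) \<Rightarrow> real" where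
  "weighted_inner a b w f g = set_lebesgue_integral lebesgue {a..b} (\<lambda>x. f x * g x * w x)"

definition monic_orthogonal_polys ::
    "real \<Rightarrow> real \<Rightarrow> (real \<Rightarrow> real) \<Rightarrow> (nat \<Rightarrow> real poly) \<Rightarrow> bool" where
  "monic_orthogonal_polys a b w p \<longleftrightarrow>
     (\<forall>n. degree (p n) = n \<and> lead_coeff (p n) = 1) \<and>
     (\<forall>m n. m \<noteq> n \<longrightarrow> weighted_inner a b w (poly (p n)) (poly (p m)) = 0)"

definition recurrence_coeff ::
    "real \<Rightarrow> real \<Rightarrow> (real \<Rightarrow> real) \<Rightarrow> (nat \<Rightarrow> real poly) \<Rightarrow> nat \<Rightarrow> real" where
  "recurrence_coeff a b w p n =
     weighted_inner a b w (\<lambda>x. x * poly (p n) x) (poly (p n)) /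
     weighted_inner a b w (poly (p n)) (poly (p n))"

text \<open>The index is that of \<open>p n\<close>: \<open>anti_gauss_poly a b w p n\<close> is the anti-Gauss polynomial
  of degree \<open>n + 1\<close>.  The same shift applies to the nodes and the interpolant below.\<close>

definition anti_gauss_poly ::
    "real \<Rightarrow> real \<Rightarrow> (real \<Rightarrow> real) \<Rightarrow> (nat \<Rightarrow> real poly) \<Rightarrow> nat \<Rightarrow> real poly" where
  "anti_gauss_poly a b w p n =
     smult 2 (p (n + 1)) + [:recurrence_coeff a b w p n, -1:] * p n"

text \<open>The nodes are the real zeros, listed in increasing order and numbered from \<open>1\<close>.
  The index \<open>k\<close> is meant to range over \<open>{1..n+1}\<close>: since the anti-Gauss polynomial has
  \<open>n + 1\<close> distinct real zeros, these values enumerate them without repetition.  This is not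
  built into the definition.\<close>

definition anti_gauss_node ::
    "real \<Rightarrow> real \<Rightarrow> (real \<Rightarrow> real) \<Rightarrow> (nat \<Rightarrow> real poly) \<Rightarrow> nat \<Rightarrow> nat \<Rightarrow> real" where
  "anti_gauss_node a b w p n k =
     sorted_list_of_set {z. poly (anti_gauss_poly a b w p n) z = 0} ! (k - 1)"

definition anti_gauss_basis ::
    "real \<Rightarrow> real \<Rightarrow> (real \<Rightarrow> real) \<Rightarrow> (nat \<Rightarrow> real poly) \<Rightarrow> nat \<Rightarrow> nat \<Rightarrow> real \<Rightarrow> real" where
  "anti_gauss_basis a b w p n k x =
     (\<Prod>j\<in>{1..n+1} - {k}.
        (x - anti_gauss_node a b w p n j) /
        (anti_gauss_node a b w p n k - anti_gauss_node a b w p n j))"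

definition anti_gauss_interpolant ::
    "real \<Rightarrow> real \<Rightarrow> (real \<Rightarrow> real) \<Rightarrow> (nat \<Rightarrow> real poly) \<Rightarrow> nat \<Rightarrow> (real \<Rightarrow> real) \<Rightarrow> real \<Rightarrow> real" where
  "anti_gauss_interpolant a b w p n f x =
     (\<Sum>k=1..n+1. anti_gauss_basis a b w p n k x * f (anti_gauss_node a b w p n k))"

definition barycentric_weight ::
    "real \<Rightarrow> real \<Rightarrow> (real \<Rightarrow> real) \<Rightarrow> (nat \<Rightarrow> real poly) \<Rightarrow> nat \<Rightarrow> nat \<Rightarrow> real" where
  "barycentric_weight a b w p n k =
     1 / poly (pderiv (anti_gauss_poly a b w p n)) (anti_gauss_node a b w p n k)"

end

theory Submission
  imports Defs "HOL-Computational_Algebra.Fundamental_Theorem_Algebra"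
begin

text \<open>The barycentric formula itself is algebra. If \<open>q\<close> is monic of degree \<open>card I\<close> and vanishes at the
  distinct nodes \<open>t k\<close>, then \<open>q\<close> is the node polynomial, \<open>q'(t k)\<close> is the denominator of the \<open>k\<close>-th
  Lagrange basis polynomial, and that basis polynomial is \<open>q(x) * (\<omega> k / (x - t k))\<close>. The basis
  polynomials sum to \<open>1\<close> (\<open>sum_lagrange_basis\<close>), so \<open>q(x)\<close> is the reciprocal of the sum of the
  \<open>\<omega> k / (x - t k)\<close>; eliminating it gives \<open>barycentric_form\<close>.

  The substance is that the anti-Gauss polynomial \<open>q\<close> of degree \<open>n + 1\<close> really has \<open>n + 1\<close> distinct
  real zeros: only then do the listed nodes exhaust its degree. By \<open>three_term_recurrence\<close>,
  \<open>p (n + 1) = (x - \<alpha> n) p n - \<beta> p (n - 1)\<close> with \<open>\<beta> > 0\<close>, for \<open>n \<ge> 1\<close>. Substituting this into the definition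
  gives \<open>q = (x - \<alpha> n) p n - 2 \<beta> p (n - 1)\<close>: the anti-Gauss polynomial continues the sequence
  \<open>p 0, ..., p n\<close> by one more step of the same kind, with the coefficient doubled but still positive.
  Every such step preserves two properties of consecutive polynomials \<open>P\<close>, \<open>Q\<close>
  (\<open>interlacing_pair_step\<close>): the quotient \<open>Q / P\<close> maps the open upper half plane into itself, and the
  Wronskian \<open>Q' P - Q P'\<close> is positive on the real line. The first excludes nonreal zeros of \<open>Q\<close>, the
  second excludes multiple real ones.\<close>

section \<open>Orthogonal polynomials of a weight\<close>

locale weighted_interval =
  fixes a b :: real and w :: "real \<Rightarrow> real"
  assumes weight: "weight_function a b w"
begin

definition ip :: "real poly \<Rightarrow> real poly \<Rightarrow> real" where
  "ip f g = weighted_inner a b w (poly f) (poly g)"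

lemma poly_weight_integrable: "set_integrable lebesgue {a..b} (\<lambda>x. poly r x * w x)"
proof -
  have "set_integrable lebesgue {a..b} (\<lambda>x. x ^ k * w x)" for k :: nat
    using weight unfolding weight_function_def by blast
  hence "integrable lebesgue
           (\<lambda>x. \<Sum>k\<le>degree r. coeff r k * (indicator {a..b} x *\<^sub>R (x ^ k * w x)))"
    unfolding set_integrable_def by (intro Bochner_Integration.integrable_sum integrable_mult_right)
  thus ?thesis
    unfolding set_integrable_def
    by (simp add: poly_altdef sum_distrib_left sum_distrib_right algebra_simps)
qed

lemma ip_eq_moment: "ip f g = set_lebesgue_integral lebesgue {a..b} (\<lambda>x. poly (f * g) x * w x)"
  by (simp add: ip_def weighted_inner_def)

lemma ip_commute: "ip f g = ip g f"
  by (simp add: ip_eq_moment mult.commute)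

text \<open>Multiplication by \<open>x\<close> is symmetric for the inner product. This is what cuts the recurrence down to
  three terms.\<close>

lemma ip_pCons_0: "ip (pCons 0 f) g = ip f (pCons 0 g)"
  by (simp add: ip_eq_moment)

lemma ip_add_left: "ip (f + g) h = ip f h + ip g h"
  using set_integral_add(2)[OF poly_weight_integrable[of "f * h"] poly_weight_integrable[of "g * h"]]
  by (simp add: ip_eq_moment algebra_simps)

lemma ip_smult_left: "ip (smult c f) g = c * ip f g"
  by (simp add: ip_eq_moment mult.assoc)

lemma ip_diff_left: "ip (f - g) h = ip f h - ip g h"
  using ip_add_left[of f "smult (-1) g" h] ip_smult_left[of "-1" g h] by simp

lemma ip_zero_left: "ip 0 g = 0"
  using ip_smult_left[of 0 0 g] by simp

text \<open>If the integral of \<open>r\<^sup>2 w\<close> were zero, then \<open>w\<close> would vanish almost everywhere, because \<open>r\<close> has only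
  finitely many zeros; but the integral of \<open>w\<close> is positive.\<close>

lemma ip_self_pos:
  assumes "r \<noteq> 0"
  shows "0 < ip r r"
proof (rule ccontr)
  assume neg: "\<not> 0 < ip r r"
  define h where "h = (\<lambda>x. indicator {a..b} x *\<^sub>R (poly (r * r) x * w x))"
  have int: "integrable lebesgue h"
    using poly_weight_integrable[of "r * r"] unfolding h_def set_integrable_def .
  have nonneg: "0 \<le> h x" for x
    using weight by (auto simp: h_def weight_function_def indicator_def)
  have "ip r r = integral\<^sup>L lebesgue h"
    by (simp add: ip_eq_moment h_def set_lebesgue_integral_def)
  moreover have "0 \<le> integral\<^sup>L lebesgue h"
    using nonneg by simp
  ultimately have "integral\<^sup>L lebesgue h = 0" using neg by simp
  hence ae: "AE x in lebesgue. h x = 0"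
    using integral_nonneg_eq_0_iff_AE[OF int] nonneg by simp
  have "negligible {x. poly r x = 0}"
    using poly_roots_finite[OF assms] by (rule negligible_finite)
  hence "AE x in lebesgue. poly r x \<noteq> 0"
    by (intro AE_I'[of "{x. poly r x = 0}"]) (auto simp: negligible_iff_null_sets)
  with ae have "AE x in lebesgue. indicator {a..b} x *\<^sub>R w x = 0"
    by eventually_elim (auto simp: h_def)
  hence "set_lebesgue_integral lebesgue {a..b} w = 0"
    unfolding set_lebesgue_integral_def by (rule integral_eq_zero_AE)
  with weight show False by (simp add: weight_function_def)
qed

end

locale weighted_orthogonal_polys = weighted_interval +
  fixes p :: "nat \<Rightarrow> real poly"
  assumes orthogonal: "monic_orthogonal_polys a b w p"
begin

lemma degree_p [simp]: "degree (p n) = n"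
  and coeff_p_self [simp]: "coeff (p n) n = 1"
  using orthogonal by (auto simp: monic_orthogonal_polys_def dest: spec[of _ n])

lemma p_nonzero: "p n \<noteq> 0"
  using coeff_p_self[of n] by fastforce

lemma p_0: "p 0 = 1"
  using degree_p[of 0] coeff_p_self[of 0] by (metis degree_eq_zeroE coeff_pCons_0 one_pCons)

lemma ip_p_p: "m \<noteq> n \<Longrightarrow> ip (p m) (p n) = 0"
  using orthogonal by (auto simp: ip_def monic_orthogonal_polys_def)

text \<open>Subtracting a multiple of \<open>p (degree r)\<close> from \<open>r\<close> lowers its degree, so \<open>r\<close> reduces step by step to
  a combination of the \<open>p j\<close> with \<open>j < n\<close>.\<close>

lemma ip_p_lower_degree:
  assumes "r = 0 \<or> degree r < n"
  shows "ip r (p n) = 0"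
  using assms
proof (induction "degree r" arbitrary: r rule: less_induct)
  case less
  show ?case
  proof (cases "r = 0")
    case False
    define s where "s = r - smult (lead_coeff r) (p (degree r))"
    have deg: "degree s \<le> degree r"
      unfolding s_def by (intro degree_diff_le degree_smult_le[THEN order_trans]) auto
    have "coeff s (degree r) = 0" by (simp add: s_def)
    hence "s = 0 \<or> degree s < degree r"
      using deg by (metis eq_zero_or_degree_less)
    hence "ip s (p n) = 0"
      using less.hyps[of s] less.prems False ip_zero_left by fastforce
    moreover have "r = s + smult (lead_coeff r) (p (degree r))" by (simp add: s_def)
    ultimately show ?thesis
      using less.prems False ip_p_p[of "degree r" n]
      by (metis add.right_neutral ip_add_left ip_smult_left mult_zero_right nat_neq_iff)
  qed (simp add: ip_zero_left)
qed

text \<open>Pairing \<open>d\<close> with \<open>p (degree d)\<close> sees only the leading term, so it gives the leading coefficient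
  times a positive number.\<close>

lemma eq_zero_if_orthogonal:
  assumes "\<And>j. j \<le> degree d \<Longrightarrow> ip d (p j) = 0"
  shows "d = 0"
proof (rule ccontr)
  assume nz: "d \<noteq> 0"
  let ?m = "degree d"
  define s where "s = d - smult (lead_coeff d) (p ?m)"
  have "degree s \<le> ?m"
    unfolding s_def by (intro degree_diff_le degree_smult_le[THEN order_trans]) auto
  moreover have "coeff s ?m = 0" by (simp add: s_def)
  ultimately have "s = 0 \<or> degree s < ?m" by (metis eq_zero_or_degree_less)
  hence "ip s (p ?m) = 0" by (rule ip_p_lower_degree)
  hence "ip d (p ?m) = lead_coeff d * ip (p ?m) (p ?m)"
    by (simp add: s_def ip_diff_left ip_smult_left)
  with assms[of ?m] nz ip_self_pos[OF p_nonzero[of ?m]] show False by simp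
qed

abbreviation \<alpha> :: "nat \<Rightarrow> real" where
  "\<alpha> n \<equiv> recurrence_coeff a b w p n"

lemma \<alpha>_eq: "\<alpha> n = ip (pCons 0 (p n)) (p n) / ip (p n) (p n)"
proof -
  have "(\<lambda>x. x * poly (p n) x) = poly (pCons 0 (p n))" by auto
  thus ?thesis unfolding recurrence_coeff_def ip_def by simp
qed

text \<open>Let \<open>d\<close> be the difference of the two sides. Its degree is at most \<open>n + 1\<close>, and it is orthogonal to
  every \<open>p j\<close> with \<open>j \<le> n + 1\<close>: for \<open>j = n + 1\<close> and \<open>j = n\<close> by the choice of \<open>\<alpha>\<close> and \<open>\<beta>\<close>, and for
  smaller \<open>j\<close> because \<open>x p (n + 1)\<close> pairs with \<open>p j\<close> as \<open>p (n + 1)\<close> does with \<open>x p j\<close>.  The coefficient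
  \<open>\<beta>\<close> is a quotient of two squared norms, since \<open>x p n\<close> and \<open>p (n + 1)\<close> have the same leading term.\<close>

lemma three_term_recurrence:
  obtains \<beta> where "\<beta> > 0" "p (n + 2) = [:- \<alpha> (n + 1), 1:] * p (n + 1) - smult \<beta> (p n)"
proof
  define \<beta> where "\<beta> = ip (pCons 0 (p (n+1))) (p n) / ip (p n) (p n)"
  have pos: "0 < ip (p m) (p m)" for m by (intro ip_self_pos p_nonzero)
  have "ip (pCons 0 (p (n+1))) (p n) = ip (pCons 0 (p n)) (p (n+1))"
    by (metis ip_pCons_0 ip_commute)
  also have "\<dots> = ip (pCons 0 (p n) - p (n+1)) (p (n+1)) + ip (p (n+1)) (p (n+1))"
    by (simp only: ip_diff_left)
  also have "ip (pCons 0 (p n) - p (n+1)) (p (n+1)) = 0"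
  proof (rule ip_p_lower_degree)
    have "degree (pCons 0 (p n) - p (n+1)) \<le> n+1"
      by (intro degree_diff_le) (auto simp: p_nonzero)
    moreover have "coeff (pCons 0 (p n) - p (n+1)) (n+1) = 0" by simp
    ultimately show "pCons 0 (p n) - p (n+1) = 0 \<or> degree (pCons 0 (p n) - p (n+1)) < n+1"
      by (metis eq_zero_or_degree_less)
  qed
  finally show "\<beta> > 0" using pos[of n] pos[of "n+1"] by (simp add: \<beta>_def)
  define d where "d = p (n+2) - pCons 0 (p (n+1)) + smult (\<alpha> (n+1)) (p (n+1)) + smult \<beta> (p n)"
  have "degree d \<le> n + 2"
    unfolding d_def
    by (intro degree_add_le degree_diff_le degree_smult_le[THEN order_trans])
       (auto simp: p_nonzero)
  moreover have "coeff d (n+2) = 0"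
    by (simp add: d_def coeff_eq_0)
  ultimately have "d = 0 \<or> degree d < n + 2" by (metis eq_zero_or_degree_less)
  hence degd: "degree d \<le> n + 1" by auto
  have "d = 0"
  proof (rule eq_zero_if_orthogonal)
    fix j assume "j \<le> degree d"
    with degd have j: "j \<le> n + 1" by simp
    have exp: "ip d (p j) = - ip (pCons 0 (p (n+1))) (p j) + \<alpha> (n+1) * ip (p (n+1)) (p j)
                              + \<beta> * ip (p n) (p j)"
      using j ip_p_p[of "n+2" j]
      by (simp only: d_def ip_add_left ip_diff_left ip_smult_left)
    consider "j = n + 1" | "j = n" | "j < n" using j by linarith
    thus "ip d (p j) = 0"
    proof cases
      case 1
      thus ?thesis using exp pos[of "n+1"] ip_p_p[of n "n+1"]
        by (simp add: \<alpha>_eq)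
    next
      case 2
      thus ?thesis using exp pos[of n] ip_p_p[of "n+1" n]
        by (simp add: \<beta>_def)
    next
      case 3
      have "ip (pCons 0 (p (n+1))) (p j) = ip (pCons 0 (p j)) (p (n+1))"
        by (metis ip_pCons_0 ip_commute)
      also have "\<dots> = 0"
        by (rule ip_p_lower_degree) (use 3 in \<open>auto simp: p_nonzero\<close>)
      finally show ?thesis using exp 3 ip_p_p[of "n+1" j] ip_p_p[of n j]
        by simp
    qed
  qed
  thus "p (n + 2) = [:- \<alpha> (n + 1), 1:] * p (n + 1) - smult \<beta> (p n)"
    by (simp add: d_def algebra_simps)
qed

end

section \<open>Real simple roots from a three-term recurrence\<close>

abbreviation cpoly :: "real poly \<Rightarrow> complex \<Rightarrow> complex" where
  "cpoly p z \<equiv> poly (map_poly of_real p) z"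

lemma cpoly_add: "cpoly (p + q) z = cpoly p z + cpoly q z"
  by (induction p q rule: poly_induct2) (simp_all add: map_poly_pCons algebra_simps)

lemma cpoly_smult: "cpoly (smult c p) z = of_real c * cpoly p z"
  by (induction p) (simp_all add: map_poly_pCons algebra_simps)

lemma cpoly_diff: "cpoly (p - q) z = cpoly p z - cpoly q z"
  using cpoly_add[of "p - q" q z] by simp

lemma cpoly_mult: "cpoly (p * q) z = cpoly p z * cpoly q z"
  by (induction p) (simp_all add: cpoly_add cpoly_smult map_poly_pCons algebra_simps)

lemma cpoly_of_real: "cpoly p (of_real x) = of_real (poly p x)"
  by (induction p) (simp_all add: map_poly_pCons)

lemma cpoly_cnj: "cpoly p (cnj z) = cnj (cpoly p z)"
  by (induction p) (simp_all add: map_poly_pCons)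

text \<open>A real root exists by the fundamental theorem of algebra. Splitting off its linear factor keeps both
  hypotheses, and simplicity says that the root does not return in the cofactor.\<close>

lemma card_real_roots_eq_degree:
  fixes q :: "real poly"
  assumes "q \<noteq> 0" "\<And>z. cpoly q z = 0 \<Longrightarrow> z \<in> \<real>"
    and "\<And>x. poly q x = 0 \<Longrightarrow> poly (pderiv q) x \<noteq> 0"
  shows "card {x. poly q x = 0} = degree q"
  using assms
proof (induction "degree q" arbitrary: q)
  case 0
  then obtain c where "q = [:c:]" by (metis degree_eq_zeroE)
  with 0 show ?case by simp
next
  case (Suc m)
  have "degree (map_poly complex_of_real q) = degree q" by (rule degree_map_poly) auto
  then obtain z where z: "cpoly q z = 0"
    using alg_closed_imp_poly_has_root[of "map_poly complex_of_real q"] Suc.hyps(2) by auto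
  with Suc.prems(2) obtain r where "z = of_real r" by (auto elim: Reals_cases)
  with z have r: "poly q r = 0" by (simp add: cpoly_of_real)
  then obtain s where s: "q = [:- r, 1:] * s" by (metis poly_eq_0_iff_dvd dvdE)
  with Suc.prems have "s \<noteq> 0" by auto
  have deriv: "pderiv q = s + [:- r, 1:] * pderiv s"
    by (simp only: s pderiv_mult) (simp add: pderiv_pCons)
  have "card {x. poly s x = 0} = degree s"
  proof (rule Suc.hyps(1))
    show "m = degree s"
      using Suc.hyps(2) \<open>s \<noteq> 0\<close> by (simp add: s degree_mult_eq del: mult_pCons_left)
    show "z \<in> \<real>" if "cpoly s z = 0" for z
      using that Suc.prems(2)[of z] by (simp only: s cpoly_mult) simp
    show "poly (pderiv s) x \<noteq> 0" if "poly s x = 0" for x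
      using that Suc.prems(3)[of x] unfolding deriv by (simp add: s)
  qed fact
  moreover have "{x. poly q x = 0} = insert r {x. poly s x = 0}" by (auto simp: s)
  moreover have "poly s r \<noteq> 0" using Suc.prems(3)[OF r] by (auto simp: deriv)
  ultimately show ?case
    using poly_roots_finite[OF \<open>s \<noteq> 0\<close>] \<open>s \<noteq> 0\<close>
    by (simp add: s degree_mult_eq del: mult_pCons_left)
qed

text \<open>The first condition says that \<open>Q / P\<close> maps the open upper half plane into itself, written without
  division: \<open>Q * cnj P\<close> is \<open>Q / P\<close> times \<open>\<bar>P\<bar>\<^sup>2\<close>. The second is positivity of the Wronskian on the
  real line.\<close>

definition interlacing_pair :: "real poly \<Rightarrow> real poly \<Rightarrow> bool" where
  "interlacing_pair P Q \<longleftrightarrow>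
     (\<forall>z. Im z > 0 \<longrightarrow> Im (cpoly Q z * cnj (cpoly P z)) > 0) \<and>
     (\<forall>x. poly (pderiv Q) x * poly P x - poly Q x * poly (pderiv P) x > 0)"

lemma interlacing_pair_linear: "interlacing_pair 1 [:c, 1:]"
  by (simp add: interlacing_pair_def map_poly_pCons pderiv_pCons one_pCons)

text \<open>With \<open>R = (x + c) Q - \<beta> P\<close>, the cross terms cancel and both quantities satisfy a recurrence with
  nonnegative terms: \<open>Im (R * cnj Q) = Im z * \<bar>Q\<bar>\<^sup>2 + \<beta> * Im (Q * cnj P)\<close> and
  \<open>R' Q - R Q' = Q\<^sup>2 + \<beta> * (Q' P - Q P')\<close>. The second is the confluent Christoffel-Darboux identity
  in recursive form.\<close>

lemma interlacing_pair_step: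
  assumes "interlacing_pair P Q" "\<beta> > 0"
  shows "interlacing_pair Q ([:c, 1:] * Q - smult \<beta> P)" (is "interlacing_pair Q ?R")
  unfolding interlacing_pair_def
proof (intro conjI allI impI)
  fix z :: complex assume z: "Im z > 0"
  have PQ: "Im (cpoly Q z * cnj (cpoly P z)) > 0"
    using assms z by (simp add: interlacing_pair_def)
  have "cpoly ?R z = (of_real c + z) * cpoly Q z - of_real \<beta> * cpoly P z"
    by (simp only: cpoly_diff cpoly_mult cpoly_smult) (simp add: map_poly_pCons)
  hence "Im (cpoly ?R z * cnj (cpoly Q z)) =
      Im z * ((Re (cpoly Q z))\<^sup>2 + (Im (cpoly Q z))\<^sup>2) + \<beta> * Im (cpoly Q z * cnj (cpoly P z))"
    by (simp only:) (simp add: algebra_simps power2_eq_square)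
  thus "Im (cpoly ?R z * cnj (cpoly Q z)) > 0"
    using PQ z assms(2) by (simp add: add_nonneg_pos)
next
  fix x :: real
  have "poly (pderiv Q) x * poly P x - poly Q x * poly (pderiv P) x > 0" (is "?W > 0")
    using assms by (simp add: interlacing_pair_def)
  moreover have "poly (pderiv ?R) x * poly Q x - poly ?R x * poly (pderiv Q) x
      = (poly Q x)\<^sup>2 + \<beta> * ?W"
    by (simp only: pderiv_diff pderiv_mult pderiv_smult)
       (simp add: pderiv_pCons algebra_simps power2_eq_square)
  ultimately show "poly (pderiv ?R) x * poly Q x - poly ?R x * poly (pderiv Q) x > 0"
    using assms(2) by (simp add: add_nonneg_pos)
qed

lemma interlacing_pair_card_roots:
  assumes "interlacing_pair P Q"
  shows "card {x. poly Q x = 0} = degree Q"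
proof (rule card_real_roots_eq_degree)
  have upper: "cpoly Q z \<noteq> 0" if "Im z > 0" for z
    using assms that unfolding interlacing_pair_def
    by (metis mult_zero_left less_irrefl zero_complex.simps(2))
  show "z \<in> \<real>" if "cpoly Q z = 0" for z
  proof -
    have "\<not> Im z > 0" using that upper by blast
    moreover have "\<not> Im (cnj z) > 0" using that upper[of "cnj z"] by (auto simp: cpoly_cnj)
    ultimately show ?thesis by (simp add: complex_is_Real_iff)
  qed
  show "Q \<noteq> 0" using upper[of \<i>] by auto
  show "poly (pderiv Q) x \<noteq> 0" if "poly Q x = 0" for x
    using assms that unfolding interlacing_pair_def
    by (metis diff_zero less_irrefl mult_zero_left)
qed

context weighted_orthogonal_polys
begin

lemma p_1: obtains c where "p 1 = [:c, 1:]"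
proof
  show "p 1 = [:coeff (p 1) 0, 1:]"
    using degree_p[of 1] coeff_p_self[of 1]
    by (intro poly_eqI) (auto simp: coeff_pCons coeff_eq_0 split: nat.splits)
qed

lemma interlacing_p: "interlacing_pair (p n) (p (n + 1))"
proof (induction n)
  case 0
  show ?case using p_1 interlacing_pair_linear p_0 by (metis add_0)
next
  case (Suc n)
  obtain \<beta> where "\<beta> > 0" "p (n + 2) = [:- \<alpha> (n + 1), 1:] * p (n + 1) - smult \<beta> (p n)"
    by (rule three_term_recurrence)
  with interlacing_pair_step[OF Suc.IH, of \<beta> "- \<alpha> (n + 1)"] show ?case by simp
qed

text \<open>The case \<open>n = 0\<close> is separate, as there is no preceding polynomial; the anti-Gauss polynomial is then
  linear.\<close>

lemma interlacing_anti_gauss: "interlacing_pair (p n) (anti_gauss_poly a b w p n)"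
proof (cases n)
  case 0
  obtain c where "p 1 = [:c, 1:]" by (rule p_1)
  hence "anti_gauss_poly a b w p n = [:2 * c + \<alpha> 0, 1:]"
    using 0 by (simp add: anti_gauss_poly_def p_0)
  thus ?thesis using 0 interlacing_pair_linear by (simp add: p_0)
next
  case (Suc m)
  obtain \<beta> where \<beta>: "\<beta> > 0" "p (m + 2) = [:- \<alpha> (m + 1), 1:] * p (m + 1) - smult \<beta> (p m)"
    by (rule three_term_recurrence)
  \<comment> \<open>In \<open>2 p (n + 1)\<close> expanded by the recurrence, the extra linear term cancels one of the two copies of \<open>(x - \<alpha> n) p n\<close>
    but leaves both copies of the \<open>\<beta>\<close>-term.\<close>
  have "anti_gauss_poly a b w p n = smult 2 (p (m + 2)) - [:- \<alpha> (m + 1), 1:] * p (m + 1)"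
    by (simp add: anti_gauss_poly_def Suc algebra_simps)
  also have "\<dots> = [:- \<alpha> (m + 1), 1:] * p (m + 1) - smult (2 * \<beta>) (p m)"
    unfolding \<beta>(2) by (intro poly_eqI) (simp add: algebra_simps)
  finally show ?thesis
    using interlacing_pair_step[OF interlacing_p[of m], of "2 * \<beta>" "- \<alpha> (m + 1)"] \<beta>(1) Suc
    by simp
qed

lemma degree_anti_gauss: "degree (anti_gauss_poly a b w p n) = n + 1" (is ?deg)
  and lead_coeff_anti_gauss: "coeff (anti_gauss_poly a b w p n) (n + 1) = 1" (is ?lead)
proof -
  have "degree (anti_gauss_poly a b w p n) \<le> n + 1"
    unfolding anti_gauss_poly_def
    by (intro degree_add_le degree_smult_le[THEN order_trans])
       (auto simp: degree_mult_eq p_nonzero simp del: mult_pCons_left)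
  moreover show ?lead
    using coeff_p_self[of "Suc n"] by (simp add: anti_gauss_poly_def coeff_eq_0)
  ultimately show ?deg by (metis le_antisym le_degree zero_neq_one)
qed

text \<open>The list of zeros has length \<open>n + 1\<close>, so every index in \<open>{1..n+1}\<close> points into it and the nodes
  enumerate all the zeros without repetition.\<close>

lemma anti_gauss_nodes_bij:
  "bij_betw (anti_gauss_node a b w p n) {1..n+1} {z. poly (anti_gauss_poly a b w p n) z = 0}"
proof -
  let ?S = "{z. poly (anti_gauss_poly a b w p n) z = 0}"
  let ?xs = "sorted_list_of_set ?S"
  have card: "card ?S = n + 1"
    using interlacing_pair_card_roots[OF interlacing_anti_gauss] degree_anti_gauss by simp
  hence fin: "finite ?S" by (intro card_ge_0_finite) simp
  have "bij_betw ((!) ?xs) {..<n+1} ?S"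
    by (rule bij_betw_nth) (use fin card in auto)
  moreover have "bij_betw (\<lambda>k. k - 1) {1..n+1} {..<n+1}"
    by (rule bij_betw_byWitness[where f' = Suc]) auto
  ultimately have "bij_betw ((!) ?xs \<circ> (\<lambda>k. k - 1)) {1..n+1} ?S"
    by (rule bij_betw_trans[rotated])
  thus ?thesis by (simp add: anti_gauss_node_def o_def cong: bij_betw_cong)
qed

end

section \<open>The barycentric formula for arbitrary nodes\<close>

text \<open>The sum is a polynomial in \<open>x\<close> of degree less than \<open>card I\<close> that takes the value \<open>1\<close> at all
  \<open>card I\<close> nodes.\<close>

lemma sum_lagrange_basis:
  fixes t :: "'a \<Rightarrow> 'b::field"
  assumes "finite I" "I \<noteq> {}" "inj_on t I"
  shows "(\<Sum>k\<in>I. \<Prod>j\<in>I - {k}. (x - t j) / (t k - t j)) = 1"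
proof -
  define \<Lambda> where "\<Lambda> = (\<Sum>k\<in>I. \<Prod>j\<in>I - {k}. smult (1 / (t k - t j)) [:- t j, 1:])"
  have eval: "poly \<Lambda> y = (\<Sum>k\<in>I. \<Prod>j\<in>I - {k}. (y - t j) / (t k - t j))" for y
    unfolding \<Lambda>_def poly_sum poly_prod
    by (intro sum.cong prod.cong refl) (simp add: diff_divide_distrib)
  have card: "card (t ` I) = card I" "card I > 0"
    using assms by (auto simp: card_image card_gt_0_iff)
  have "degree \<Lambda> \<le> card I - 1"
    unfolding \<Lambda>_def
  proof (rule degree_sum_le)
    fix k assume "k \<in> I"
    have "degree (\<Prod>j\<in>I - {k}. smult (1 / (t k - t j)) [:- t j, 1:])
            \<le> (\<Sum>j\<in>I - {k}. degree (smult (1 / (t k - t j)) [:- t j, 1:]))"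
      using degree_prod_sum_le[of "I - {k}" "\<lambda>j. smult (1 / (t k - t j)) [:- t j, 1:]"] assms(1)
      by (simp only: o_def finite_Diff)
    also have "\<dots> \<le> (\<Sum>j\<in>I - {k}. 1)"
      by (intro sum_mono degree_smult_le[THEN order_trans]) auto
    finally show "degree (\<Prod>j\<in>I - {k}. smult (1 / (t k - t j)) [:- t j, 1:]) \<le> card I - 1"
      using \<open>k \<in> I\<close> assms(1) by simp
  qed fact
  moreover have "poly \<Lambda> y = poly 1 y" if y: "y \<in> t ` I" for y
  proof -
    from y obtain i where i: "i \<in> I" "y = t i" by auto
    have "(\<Prod>j\<in>I - {k}. (y - t j) / (t k - t j)) = (if k = i then 1 else 0)" if "k \<in> I" for k
    proof (cases "k = i")
      case True
      have "(\<Prod>j\<in>I - {i}. (t i - t j) / (t i - t j)) = 1"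
        using assms(3) i by (intro prod.neutral) (auto dest: inj_onD)
      with True i show ?thesis by simp
    next
      case False
      with i assms(1) show ?thesis by (auto intro!: prod_zero bexI[of _ i])
    qed
    hence "poly \<Lambda> y = (\<Sum>k\<in>I. if k = i then 1 else 0)"
      unfolding eval by (intro sum.cong) auto
    with i assms(1) show ?thesis by simp
  qed
  ultimately have "\<Lambda> = 1"
    using card by (intro poly_eqI_degree[of "t ` I"]) auto
  with eval[of x] show ?thesis by simp
qed

text \<open>Each Lagrange basis polynomial is \<open>q(x)\<close> times its barycentric term, so the common factor \<open>q(x)\<close>
  cancels against the representation of \<open>1\<close> by the same basis.\<close>

lemma barycentric_form:
  fixes q :: "'b::field poly" and t :: "'a \<Rightarrow> 'b"
  assumes fin: "finite I" "I \<noteq> {}" and inj: "inj_on t I"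
    and roots: "\<And>k. k \<in> I \<Longrightarrow> poly q (t k) = 0"
    and monic: "degree q = card I" "coeff q (card I) = 1"
    and x: "\<And>k. k \<in> I \<Longrightarrow> x \<noteq> t k"
  shows "(\<Sum>k\<in>I. (\<Prod>j\<in>I - {k}. (x - t j) / (t k - t j)) * f k) =
    (\<Sum>k\<in>I. 1 / poly (pderiv q) (t k) / (x - t k) * f k) /
    (\<Sum>k\<in>I. 1 / poly (pderiv q) (t k) / (x - t k))"
proof -
  have deg: "degree (\<Prod>j\<in>I. [:- t j, 1:]) = card I"
    by (subst degree_prod_sum_eq) auto
  have q: "q = (\<Prod>j\<in>I. [:- t j, 1:])"
  proof (rule poly_eqI_degree_lead_coeff[where A = "t ` I" and n = "card I"])
    have "lead_coeff (\<Prod>j\<in>I. [:- t j, 1:]) = 1" by (simp add: lead_coeff_prod)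
    thus "coeff q (card I) = coeff (\<Prod>j\<in>I. [:- t j, 1:]) (card I)"
      using deg monic by simp
    show "poly q z = poly (\<Prod>j\<in>I. [:- t j, 1:]) z" if z: "z \<in> t ` I" for z
      using z roots fin by (force simp: poly_prod intro!: prod_zero[symmetric])
  qed (use deg monic inj in \<open>auto simp: card_image\<close>)
  \<comment> \<open>Only the summand that omits the factor vanishing at \<open>t k\<close> survives the product rule.\<close>
  have deriv: "poly (pderiv q) (t k) = (\<Prod>j\<in>I - {k}. t k - t j)" if k: "k \<in> I" for k
  proof -
    have "poly (pderiv q) (t k) = (\<Sum>i\<in>I. \<Prod>j\<in>I - {i}. t k - t j)"
      by (simp add: q pderiv_prod pderiv_pCons poly_sum poly_prod)
    also have "\<dots> = (\<Sum>i\<in>I. if i = k then \<Prod>j\<in>I - {k}. t k - t j else 0)"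
      using k fin(1) by (intro sum.cong refl) (auto intro!: prod_zero bexI[of _ k])
    finally show ?thesis using k fin(1) by simp
  qed
  have basis: "(\<Prod>j\<in>I - {k}. (x - t j) / (t k - t j)) =
      poly q x * (1 / poly (pderiv q) (t k) / (x - t k))" if k: "k \<in> I" for k
  proof -
    have "poly q x = (x - t k) * (\<Prod>j\<in>I - {k}. x - t j)"
      unfolding q poly_prod using fin(1) k by (subst prod.remove[of I k]) auto
    thus ?thesis using x[OF k] by (simp add: prod_dividef deriv k)
  qed
  have "poly q x * (\<Sum>k\<in>I. 1 / poly (pderiv q) (t k) / (x - t k)) = 1"
    using sum_lagrange_basis[OF fin inj, of x] basis by (simp add: sum_distrib_left)
  hence "(\<Sum>k\<in>I. 1 / poly (pderiv q) (t k) / (x - t k)) = 1 / poly q x"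
    by (simp only: inverse_unique[symmetric] flip: inverse_eq_divide)
  moreover have "(\<Sum>k\<in>I. (\<Prod>j\<in>I - {k}. (x - t j) / (t k - t j)) * f k) =
      poly q x * (\<Sum>k\<in>I. 1 / poly (pderiv q) (t k) / (x - t k) * f k)"
    unfolding sum_distrib_left by (intro sum.cong refl) (simp add: basis)
  ultimately show ?thesis by simp
qed

theorem theorem3p1:
  fixes a b :: real and w :: "real \<Rightarrow> real" and p :: "nat \<Rightarrow> real poly"
    and n :: nat and f :: "real \<Rightarrow> real" and x :: real
  assumes "weight_function a b w"
    and "monic_orthogonal_polys a b w p"
    and "\<forall>k\<in>{1..n+1}. anti_gauss_node a b w p n k \<in> {a..b}"
    and "continuous_on {a..b} f"
    and "\<forall>k\<in>{1..n+1}. x \<noteq> anti_gauss_node a b w p n k"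
  shows "anti_gauss_interpolant a b w p n f x =
    (\<Sum>k=1..n+1. barycentric_weight a b w p n k / (x - anti_gauss_node a b w p n k)
                   * f (anti_gauss_node a b w p n k)) /
    (\<Sum>k=1..n+1. barycentric_weight a b w p n k / (x - anti_gauss_node a b w p n k))"
proof -
  interpret weighted_orthogonal_polys a b w p
    by unfold_locales fact+
  have inj: "inj_on (anti_gauss_node a b w p n) {1..n+1}"
    and image: "anti_gauss_node a b w p n ` {1..n+1} = {z. poly (anti_gauss_poly a b w p n) z = 0}"
    using anti_gauss_nodes_bij[of n] by (auto simp: bij_betw_def)
  show ?thesis
    unfolding anti_gauss_interpolant_def anti_gauss_basis_def barycentric_weight_def
    by (rule barycentric_form)
       (use assms(5) inj image degree_anti_gauss[of n] lead_coeff_anti_gauss[of n] in auto)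
qed

end
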